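(* Let $\mathbb{F}$ be an algebraically closed field and let $q\in\mathbb{F}$ be nonzero with $q^4\neq 1$. Let $\Delta$ be the universal Askey-Wilson algebra and $L$ the Lie subalgebra of $\Delta$ generated by $A,B,C$. The following four relations hold in $L$. (1) $$\frac{[BA^2BC]}{q-q^{-1}} = -\frac{-(2q^2+1)(q^2+2)\left([[BA^2],[CB]]+[[BAB],[CA]]\right)}{2q^2(q+q^{-1})^2(q-q^{-1})}-\frac{(q^4+3q^2+1)\left([[BAC],[BA]]-2[[CAB],[BA]]\right)}{2q^2(q+q^{-1})^2(q-q^{-1})}-[BAC^2]+2[CABC]-[BAB^2]+[BA^3].$$ (2) $$\frac{[[CB^2],[CA]]}{2(q+q^{-1})^2(q-q^{-1})}=\frac{-(3q^4+5q^2+3)[[BAC],[CB]]}{2q^2(q+q^{-1})^2(q-q^{-1})}+\frac{(q^4+3q^2+1)[[CAB],[CB]]}{2q^2(q+q^{-1})^2(q-q^{-1})}-\frac{(2q^4+3q^2+2)[[CBC],[BA]]}{2q^2(q+q^{-1})^2(q-q^{-1})}-\frac{[BABC^2]-[CAB^2C]}{q-q^{-1}}+[CBC^2]+[BA^2C]-[CB^3]+[CA^2B].$$ (3) $$\frac{[[CA^2],[CB]]}{2(q+q^{-1})^2(q-q^{-1})}=\frac{-2[[BAC],[CA]]+[[CAB],[CA]]}{2q^2(q+q^{-1})^2(q-q^{-1})}+\frac{(2q^2+1)(q^2+2)[[CAC],[BA]]}{2q^2(q+q^{-1})^2(q-q^{-1})}+\frac{[CA^2BC]}{q-q^{-1}}-2[[CB],[BA]]-[CAC^2]+2[BABC]-[CAB^2]+[CA^3].$$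 (4) $$[[CAC],[CB]]=-[[BAB],[CB]]+[[CBC],[CA]]-[[BA^2],[CA]]+[[CB^2],[BA]]+[[CA^2],[BA]].$$
   Context: $\mathbb{F}\langle A,B,C\rangle$ is the free unital associative $\mathbb{F}$-algebra; every associative algebra is a Lie algebra with $[X,Y]=XY-YX$. Put $\alpha=(q+q^{-1})A+\frac{qBC-q^{-1}CB}{q-q^{-1}}$, $\beta=(q+q^{-1})B+\frac{qCA-q^{-1}AC}{q-q^{-1}}$, $\gamma=(q+q^{-1})C+\frac{qAB-q^{-1}BA}{q-q^{-1}}$. $\Delta$ is the quotient of $\mathbb{F}\langle A,B,C\rangle$ by the two-sided ideal generated by the nine commutators $[X,\delta]$, $X\in\{A,B,C\}$, $\delta\in\{\alpha,\beta,\gamma\}$. For a word $X_1X_2\cdots X_t$ in $A,B,C$, $[X_1X_2\cdots X_t]$ denotes the left-normed bracket $[[\cdots[[X_1,X_2],X_3],\cdots],X_t]$; for example $[BA]=[B,A]$, $[BA^2BC]=[[[[B,A],A],B],C]$. An expression such as $[[BA^2],[CB]]$ is the Lie bracket of the left-normed brackets $[BA^2]$ and $[CB]$.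
   Formalization: Coefficients corrected, as the printed (1)–(3) fail: in (1) the doubled minus on (2q²+1)(q²+2) is a single minus; in (2) the [[CBC],[BA]] term has sign +; in (3) the first numerator gains the factor q⁴+3q²+1. Characteristic ≠ 2 is assumed throughout, since (1)–(3) divide by 2. *)

theory Defs
  imports
    "HOL-Library.Poly_Mapping"
    "HOL-Computational_Algebra.Polynomial"
    "HOL-Algebra.Module"
    "HOL-Algebra.QuotRing"
    "HOL-Algebra.Algebraic_Closure_Type"
begin

section \<open>The free unital associative algebra on three generators\<close>

datatype aw_gen = gA | gB | gC

datatype 'x word = Word (letters: "'x list")

instantiation word :: (type) monoid_add
begin

definition zero_word :: "'x word" where
  "zero_word = Word []"

definition plus_word :: "'x word \<Rightarrow> 'x word \<Rightarrow> 'x word" where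
  "plus_word u v = Word (letters u @ letters v)"

instance
  by standard (simp_all add: zero_word_def plus_word_def)

end

text \<open>
  Words form the (non-commutative, additively written) free monoid under concatenation. Hence the
  finitely supported functions on words, with the convolution product of
  \<^theory>\<open>HOL-Library.Poly_Mapping\<close>, are the free algebra.
\<close>

type_synonym 'a free_alg = "aw_gen word \<Rightarrow>\<^sub>0 'a"

definition gen :: "aw_gen \<Rightarrow> 'a::field free_alg" where
  "gen x = Poly_Mapping.single (Word [x]) 1"

definition scal :: "'a::field \<Rightarrow> 'a free_alg" where
  "scal c = Poly_Mapping.single 0 c"

section \<open>The universal Askey-Wilson algebra\<close>

definition aw_alpha :: "'a::field \<Rightarrow> 'a free_alg" where
  "aw_alpha q = scal (q + inverse q) * gen gA
     + scal (inverse (q - inverse q)) *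
         (scal q * gen gB * gen gC - scal (inverse q) * gen gC * gen gB)"

definition aw_beta :: "'a::field \<Rightarrow> 'a free_alg" where
  "aw_beta q = scal (q + inverse q) * gen gB
     + scal (inverse (q - inverse q)) *
         (scal q * gen gC * gen gA - scal (inverse q) * gen gA * gen gC)"

definition aw_gamma :: "'a::field \<Rightarrow> 'a free_alg" where
  "aw_gamma q = scal (q + inverse q) * gen gC
     + scal (inverse (q - inverse q)) *
         (scal q * gen gA * gen gB - scal (inverse q) * gen gB * gen gA)"

abbreviation free_ring :: "'a::field free_alg ring" where
  "free_ring \<equiv> ring_of_type_algebra"

definition aw_ideal :: "'a::field \<Rightarrow> 'a free_alg set" where
  "aw_ideal q = Idl\<^bsub>free_ring\<^esub>
     {gen x * d - d * gen x | x d. d \<in> {aw_alpha q, aw_beta q, aw_gamma q}}"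

text \<open>
  The locale \<^locale>\<open>algebra\<close> of the library covers commutative algebras only, but its record type
  does not require commutativity. Scalars act on the quotient through the unit map
  of the free algebra, whose image is central.
\<close>

definition AW_algebra :: "'a::field \<Rightarrow> ('a, 'a free_alg set) module" where
  "AW_algebra q =
     (let Q = free_ring Quot aw_ideal q in
      \<lparr>carrier = carrier Q, monoid.mult = monoid.mult Q, one = one Q, zero = zero Q, add = add Q,
       module.smult = (\<lambda>c x. (aw_ideal q +>\<^bsub>free_ring\<^esub> scal c) \<otimes>\<^bsub>Q\<^esub> x)\<rparr>)"

definition AW_gen :: "'a::field \<Rightarrow> aw_gen \<Rightarrow> 'a free_alg set" where
  "AW_gen q x = aw_ideal q +>\<^bsub>free_ring\<^esub> gen x"

section \<open>Lie brackets and generated Lie subalgebras\<close>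

definition lie_bracket :: "('b, 'm) ring_scheme \<Rightarrow> 'b \<Rightarrow> 'b \<Rightarrow> 'b"
    (\<open>\<lbrace>_,/ _\<rbrace>\<index>\<close>) where
  "lie_bracket R x y = x \<otimes>\<^bsub>R\<^esub> y \<ominus>\<^bsub>R\<^esub> y \<otimes>\<^bsub>R\<^esub> x"

text \<open>Only meaningful for nonempty lists; a one-letter word is the letter itself.\<close>

definition left_normed :: "('b, 'm) ring_scheme \<Rightarrow> 'b list \<Rightarrow> 'b" (\<open>\<langle>_\<rangle>\<index>\<close>) where
  "left_normed R xs = foldl (lie_bracket R) (hd xs) (tl xs)"

definition lie_subalgebra :: "('a::field, 'b, 'm) module_scheme \<Rightarrow> 'b set \<Rightarrow> bool" where
  "lie_subalgebra M H \<longleftrightarrow>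
     submodule H (ring_of_type_algebra :: 'a ring) M \<and>
     (\<forall>x\<in>H. \<forall>y\<in>H. lie_bracket M x y \<in> H)"

definition lie_generated :: "('a::field, 'b, 'm) module_scheme \<Rightarrow> 'b set \<Rightarrow> 'b set" where
  "lie_generated M S = \<Inter>{H. lie_subalgebra M H \<and> S \<subseteq> H}"

section \<open>Basic facts\<close>

lemma ring_free_ring: "ring (free_ring :: 'a::field free_alg ring)"
proof -
  have "\<exists>y. x + y = 0" for x :: "'a free_alg"
    using add.right_inverse by blast
  thus ?thesis
    unfolding ring_of_type_algebra_def using add.right_inverse
    by unfold_locales (auto simp: algebra_simps Units_def)
qed

lemma carrier_free_ring [simp]: "carrier free_ring = UNIV"
  by (simp add: ring_of_type_algebra_def)

lemma aw_ideal_is_ideal: "ideal (aw_ideal q) free_ring"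
  unfolding aw_ideal_def by (rule ring.genideal_ideal[OF ring_free_ring]) simp

lemma ring_AW_algebra: "ring (AW_algebra q)"
proof -
  interpret Q: ring "free_ring Quot aw_ideal q"
    by (rule ideal.quotient_is_ring[OF aw_ideal_is_ideal])
  show ?thesis
    using Q.ring_axioms
    unfolding AW_algebra_def Let_def ring_def abelian_group_def abelian_monoid_def
      abelian_group_axioms_def ring_axioms_def monoid_def comm_group_def comm_monoid_def
      comm_monoid_axioms_def group_def group_axioms_def Units_def
    by (simp (no_asm_use))
qed

lemma AW_smult_coset:
  "c \<odot>\<^bsub>AW_algebra q\<^esub> (aw_ideal q +>\<^bsub>free_ring\<^esub> x) = aw_ideal q +>\<^bsub>free_ring\<^esub> (scal c * x)"
  by (simp add: AW_algebra_def Let_def FactRing_def ideal.rcoset_mult_add[OF aw_ideal_is_ideal])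
     (simp add: ring_of_type_algebra_def)

lemma scal_central: "scal c * x = x * scal c"
proof (induction x rule: update_induct)
  case const
  show ?case by simp
next
  case (update f a b)
  have "Poly_Mapping.update a b f = Poly_Mapping.single a b + f"
    using update(1)
    by (intro poly_mapping_eqI) (auto simp: lookup_update lookup_add lookup_single in_keys_iff when_def)
  then show ?case
    using update(3) by (simp add: distrib_left distrib_right)
      (simp add: scal_def mult_single mult.commute)
qed

lemma generators_in_lie_generated: "S \<subseteq> lie_generated M S"
  by (auto simp: lie_generated_def)

end

theory Submission
  imports Defs
begin

text \<open>
  After clearing denominators, the difference of the two sides of each relation is an explicit
  combination of products and iterated (anti)commutators in the free algebra that involve the
  elements $[X, q^2 (q - q^{-1}) \delta]$, where $\delta \in
  \{\alpha, \beta, \gamma\}$, and therefore lies in the defining ideal. The combinations were found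
  by linear algebra at several values of \<open>q\<close>. They are identities in the free algebra over
  $\mathbb{Z}[q]$ and are checked there by comparing coefficients.
\<close>

section \<open>Brackets and the four relations\<close>

text \<open>Only syntactic classes are required, so that brackets can also be formed on the
  representations \<open>ncpoly\<close> below, where for instance \<open>x - x\<close> need not be
  \<open>Zero\<close>.\<close>

definition comm :: "'b \<Rightarrow> 'b \<Rightarrow> 'b::{minus, times}" where
  "comm x y = x * y - y * x"

definition anticomm :: "'b \<Rightarrow> 'b \<Rightarrow> 'b::{plus, times}" where
  "anticomm x y = x * y + y * x"

definition lnbr :: "'b list \<Rightarrow> 'b::{minus, times}" where
  "lnbr xs = foldl comm (hd xs) (tl xs)"

text \<open>
  A list \<open>[c\<^sub>0, c\<^sub>1, \<dots>]\<close> of integers stands for the polynomial $c_0 + c_1 q + \cdots$, and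
  \<open>s\<close> is the scalar action of such polynomials. The action is a parameter so that the same
  expression can be read both in the free algebra and in its computational model below. The
  functions \<open>relation1\<close>, \<open>relation2\<close>, \<open>relation3\<close> are the differences of the two sides of the
  relations multiplied by $4 q^4 (q + q^{-1})^2 (q - q^{-1})$. The arguments \<open>a b g\<close> of the
  functions \<open>combination1\<close>, \<dots>, \<open>combination4\<close> stand for $q^2 (q - q^{-1})$ times
  $\alpha, \beta, \gamma$.
\<close>

definition relation1 :: "(int list \<Rightarrow> 'b \<Rightarrow> 'b) \<Rightarrow> 'b \<Rightarrow> 'b \<Rightarrow> 'b \<Rightarrow> 'b::{plus, minus, times}" where
  "relation1 s A B C =
     s [0,0,4,0,8,0,4] (lnbr [B,A,A,B,C])
     + s [0,0,4,0,10,0,4] (comm (lnbr [B,A,A]) (lnbr [C,B]) + comm (lnbr [B,A,B]) (lnbr [C,A]))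
     + s [0,0,2,0,6,0,2] (comm (lnbr [B,A,C]) (lnbr [B,A]) - s [2] (comm (lnbr [C,A,B]) (lnbr [B,A])))
     + s [0,-4,0,-4,0,4,0,4]
         (lnbr [B,A,C,C] - s [2] (lnbr [C,A,B,C]) + lnbr [B,A,B,B] - lnbr [B,A,A,A])"

definition combination1 ::
    "(int list \<Rightarrow> 'b \<Rightarrow> 'b) \<Rightarrow> 'b \<Rightarrow> 'b \<Rightarrow> 'b \<Rightarrow> 'b \<Rightarrow> 'b \<Rightarrow> 'b \<Rightarrow> 'b::{plus, minus, times}" where
  "combination1 s A B C a b g =
     s [0,1,0,1]
       (s [4] (comm A (comm C (comm B g)) + comm B (comm C (comm A g))
               - comm A (comm A (comm B a)) - comm B (comm B (comm A b)))
        + s [3] (comm A (comm B (comm A a)) + comm B (comm A (comm B b)))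
        - comm C (comm B (comm A g)))
     + s [0,-1,0,1]
       (s [2] (comm B (anticomm A (comm A a)) - comm A (anticomm B (comm B b)))
        + comm C (anticomm A (comm B g)) - anticomm A (comm B (comm A a))
        + anticomm B (comm A (comm B b)) + anticomm C (comm A (comm B g))
        - anticomm C (comm B (comm A g)))
     - s [-2,0,0,0,2] (comm C (comm B b))"

definition relation2 :: "(int list \<Rightarrow> 'b \<Rightarrow> 'b) \<Rightarrow> 'b \<Rightarrow> 'b \<Rightarrow> 'b \<Rightarrow> 'b::{plus, minus, times}" where
  "relation2 s A B C =
     s [0,0,0,0,2] (comm (lnbr [C,B,B]) (lnbr [C,A]))
     - s [0,0,-6,0,-10,0,-6] (comm (lnbr [B,A,C]) (lnbr [C,B]))
     - s [0,0,2,0,6,0,2] (comm (lnbr [C,A,B]) (lnbr [C,B]))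
     - s [0,0,4,0,6,0,4] (comm (lnbr [C,B,C]) (lnbr [B,A]))
     + s [0,0,4,0,8,0,4] (lnbr [B,A,B,C,C] - lnbr [C,A,B,B,C])
     - s [0,-4,0,-4,0,4,0,4]
         (lnbr [C,B,C,C] + lnbr [B,A,A,C] - lnbr [C,B,B,B] + lnbr [C,A,A,B])"

definition combination2 ::
    "(int list \<Rightarrow> 'b \<Rightarrow> 'b) \<Rightarrow> 'b \<Rightarrow> 'b \<Rightarrow> 'b \<Rightarrow> 'b \<Rightarrow> 'b \<Rightarrow> 'b \<Rightarrow> 'b::{plus, minus, times}" where
  "combination2 s A B C a b g =
     s [0,1,0,1]
       (s [2] (comm A (comm B (comm C a)) + comm (comm C B) (comm B b))
        + s [4] (comm B (comm B (comm C b)) + comm C (comm C (comm B g)))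
        - s [5] (comm B (comm A (comm C a)) + comm C (comm A (comm B a)))
        + s [3] (comm C (comm B (comm A a))) + comm B (comm C (comm A a)))
     + s [0,-1,0,1]
       (s [2] (comm A (anticomm C (comm B a)))
        + comm C (anticomm B (comm A a)) + anticomm B (comm A (comm C a))
        - anticomm B (comm C (comm A a)) - anticomm C (comm A (comm B a)))
     + s [-2,0,0,0,2] (comm A (comm A a))"

definition relation3 :: "(int list \<Rightarrow> 'b \<Rightarrow> 'b) \<Rightarrow> 'b \<Rightarrow> 'b \<Rightarrow> 'b \<Rightarrow> 'b::{plus, minus, times}" where
  "relation3 s A B C =
     s [0,0,0,0,2] (comm (lnbr [C,A,A]) (lnbr [C,B]))
     - s [0,0,2,0,6,0,2]
         (s [-2] (comm (lnbr [B,A,C]) (lnbr [C,A])) + comm (lnbr [C,A,B]) (lnbr [C,A]))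
     - s [0,0,4,0,10,0,4] (comm (lnbr [C,A,C]) (lnbr [B,A]))
     - s [0,0,4,0,8,0,4] (lnbr [C,A,A,B,C])
     + s [0,-4,0,-4,0,4,0,4]
         (s [2] (comm (lnbr [C,B]) (lnbr [B,A])) + lnbr [C,A,C,C] - s [2] (lnbr [B,A,B,C])
          + lnbr [C,A,B,B] - lnbr [C,A,A,A])"

text \<open>Interchanging A and B and replacing q by its inverse swaps alpha with beta and fixes
  gamma. In the free algebra this element is q^8 times the image of \<open>combination2\<close>
  under that symmetry.\<close>

definition combination3 ::
    "(int list \<Rightarrow> 'b \<Rightarrow> 'b) \<Rightarrow> 'b \<Rightarrow> 'b \<Rightarrow> 'b \<Rightarrow> 'b \<Rightarrow> 'b \<Rightarrow> 'b \<Rightarrow> 'b::{plus, minus, times}" where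
  "combination3 s A B C a b g =
     s [0,1,0,1]
       (s [5] (comm A (comm B (comm C b)) + comm C (comm B (comm A b)))
        + s [2] (comm (comm A C) (comm A a) - comm B (comm A (comm C b)))
        - s [4] (comm A (comm A (comm C a)) + comm C (comm C (comm A g)))
        - s [3] (comm C (comm A (comm B b))) - comm A (comm C (comm B b)))
     + s [0,-1,0,1]
       (s [2] (comm B (anticomm C (comm A b)))
        - comm A (anticomm C (comm B b)) + anticomm A (comm B (comm C b))
        + anticomm C (comm A (comm B b)) - anticomm C (comm B (comm A b)))
     + s [-2,0,0,0,2] (comm B (comm B b))"

definition relation4 :: "'b \<Rightarrow> 'b \<Rightarrow> 'b \<Rightarrow> 'b::{plus, minus, times}" where
  "relation4 A B C =
     comm (lnbr [C,A,C]) (lnbr [C,B]) + comm (lnbr [B,A,B]) (lnbr [C,B])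
     - comm (lnbr [C,B,C]) (lnbr [C,A]) + comm (lnbr [B,A,A]) (lnbr [C,A])
     - comm (lnbr [C,B,B]) (lnbr [B,A]) - comm (lnbr [C,A,A]) (lnbr [B,A])"

text \<open>One expression summed over the rotation A -> B -> C -> A, a -> b -> g -> a. The relation
  has the same symmetry: with u = [A,B], v = [B,C], w = [C,A], \<open>relation4\<close> is the
  cyclic sum of [[u,B],v] - [[u,A],w].\<close>

definition combination4 ::
    "(int list \<Rightarrow> 'b \<Rightarrow> 'b) \<Rightarrow> 'b \<Rightarrow> 'b \<Rightarrow> 'b \<Rightarrow> 'b \<Rightarrow> 'b \<Rightarrow> 'b \<Rightarrow> 'b::{plus, minus, times}" where
  "combination4 s A B C a b g =
     comm A B * comm A b + comm B a * comm A B - s [0,0,1] (comm A b * comm A B + comm A B * comm B a)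
     + (comm B C * comm B g + comm C b * comm B C - s [0,0,1] (comm B g * comm B C + comm B C * comm C b))
     + (comm C A * comm C a + comm A g * comm C A - s [0,0,1] (comm C a * comm C A + comm C A * comm A g))"

section \<open>A computational model of the free algebra over the integer polynomials\<close>

fun poly_eval :: "'a::comm_ring_1 \<Rightarrow> int list \<Rightarrow> 'a" where
  "poly_eval q [] = 0"
| "poly_eval q (c # cs) = of_int c + q * poly_eval q cs"

fun poly_add :: "int list \<Rightarrow> int list \<Rightarrow> int list" where
  "poly_add [] ds = ds"
| "poly_add cs [] = cs"
| "poly_add (c # cs) (d # ds) = (c + d) # poly_add cs ds"

fun poly_mult :: "int list \<Rightarrow> int list \<Rightarrow> int list" where
  "poly_mult [] ds = []"
| "poly_mult (c # cs) ds = poly_add (map ((*) c) ds) (0 # poly_mult cs ds)"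

lemma poly_eval_add [simp]: "poly_eval q (poly_add cs ds) = poly_eval q cs + poly_eval q ds"
  by (induction cs ds rule: poly_add.induct) (simp_all add: algebra_simps)

lemma poly_eval_map [simp]: "poly_eval q (map ((*) c) ds) = of_int c * poly_eval q ds"
  by (induction ds) (simp_all add: algebra_simps)

lemma poly_eval_mult [simp]: "poly_eval q (poly_mult cs ds) = poly_eval q cs * poly_eval q ds"
  by (induction cs) (simp_all add: algebra_simps)

lemma poly_eval_eq_0: "list_all ((=) 0) cs \<Longrightarrow> poly_eval q cs = 0"
  by (induction cs) auto

section \<open>Noncommutative polynomials over these coefficients\<close>

text \<open>
  Horner form: \<open>Node c t\<^sub>A t\<^sub>B t\<^sub>C\<close> represents $c + A t_A + B t_B + C t_C$.
\<close>

datatype ncpoly = Zero | Node "int list" ncpoly ncpoly ncpoly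

fun nc_scale :: "int list \<Rightarrow> ncpoly \<Rightarrow> ncpoly" where
  "nc_scale p Zero = Zero"
| "nc_scale p (Node c x y z) = Node (poly_mult p c) (nc_scale p x) (nc_scale p y) (nc_scale p z)"

fun nc_add :: "ncpoly \<Rightarrow> ncpoly \<Rightarrow> ncpoly" where
  "nc_add Zero t = t"
| "nc_add t Zero = t"
| "nc_add (Node c x y z) (Node c' x' y' z') =
     Node (poly_add c c') (nc_add x x') (nc_add y y') (nc_add z z')"

text \<open>An empty constant term is short-circuited, since \<open>nc_scale [] t\<close> would be a
  full copy of the tree \<open>t\<close> with empty coefficients.\<close>

fun nc_mult :: "ncpoly \<Rightarrow> ncpoly \<Rightarrow> ncpoly" where
  "nc_mult Zero t = Zero"
| "nc_mult (Node c x y z) t =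
     nc_add (if c = [] then Zero else nc_scale c t)
       (Node [] (nc_mult x t) (nc_mult y t) (nc_mult z t))"

text \<open>Zero has many representations (padded coefficient lists, nodes with empty coefficients),
  so every coefficient is inspected instead of comparing with \<open>Zero\<close>.\<close>

fun nc_null :: "ncpoly \<Rightarrow> bool" where
  "nc_null Zero \<longleftrightarrow> True"
| "nc_null (Node c x y z) \<longleftrightarrow> list_all ((=) 0) c \<and> nc_null x \<and> nc_null y \<and> nc_null z"

instantiation ncpoly :: "{plus, minus, times}"
begin

definition plus_ncpoly :: "ncpoly \<Rightarrow> ncpoly \<Rightarrow> ncpoly" where
  "plus_ncpoly = nc_add"

definition minus_ncpoly :: "ncpoly \<Rightarrow> ncpoly \<Rightarrow> ncpoly" where
  "minus_ncpoly x y = nc_add x (nc_scale [-1] y)"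

definition times_ncpoly :: "ncpoly \<Rightarrow> ncpoly \<Rightarrow> ncpoly" where
  "times_ncpoly = nc_mult"

instance ..

end

fun nc_gen :: "aw_gen \<Rightarrow> ncpoly" where
  "nc_gen gA = Node [] (Node [1] Zero Zero Zero) Zero Zero"
| "nc_gen gB = Node [] Zero (Node [1] Zero Zero Zero) Zero"
| "nc_gen gC = Node [] Zero Zero (Node [1] Zero Zero Zero)"

text \<open>The factor q^2 (q - q^{-1}) clears the denominators of alpha and leaves (q^4 - 1) A +
  q^3 BC - q CB. Rotating the arguments cyclically gives the multiples of beta and gamma.\<close>

definition nc_alpha :: "ncpoly \<Rightarrow> ncpoly \<Rightarrow> ncpoly \<Rightarrow> ncpoly" where
  "nc_alpha x y z = nc_scale [-1,0,0,0,1] x + nc_scale [0,0,0,1] (y * z) - nc_scale [0,1] (z * y)"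

section \<open>Evaluation of the model in the free algebra\<close>

lemma scal_0 [simp]: "scal 0 = 0"
  by (simp add: scal_def)

lemma scal_1 [simp]: "scal 1 = 1"
  by (simp add: scal_def)

lemma scal_add: "scal (c + d) = scal c + scal d"
  by (simp add: scal_def single_add)

lemma scal_mult: "scal (c * d) = scal c * scal d"
  by (simp add: scal_def mult_single)

lemma scal_uminus: "scal (- c) = - scal c"
  by (simp add: scal_def single_uminus)

lemma mult_scal_left_commute: "x * (scal c * y) = scal c * (x * y)"
  by (metis mult.assoc scal_central)

abbreviation act :: "'a::field \<Rightarrow> int list \<Rightarrow> 'a free_alg \<Rightarrow> 'a free_alg" where
  "act q p x \<equiv> scal (poly_eval q p) * x"

fun nc_eval :: "'a::field \<Rightarrow> ncpoly \<Rightarrow> 'a free_alg" where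
  "nc_eval q Zero = 0"
| "nc_eval q (Node c x y z) =
     scal (poly_eval q c) + gen gA * nc_eval q x + gen gB * nc_eval q y + gen gC * nc_eval q z"

text \<open>Scalars are central, so a coefficient can be moved past the leading generators of the
  Horner form.\<close>

lemma nc_eval_scale: "nc_eval q (nc_scale p t) = act q p (nc_eval q t)"
  by (induction t)
    (simp_all add: algebra_simps scal_mult mult_scal_left_commute scal_central[of _ "scal _"])

lemma nc_eval_nc_add: "nc_eval q (nc_add t u) = nc_eval q t + nc_eval q u"
  by (induction t u rule: nc_add.induct) (simp_all add: algebra_simps scal_add)

lemma nc_eval_nc_mult: "nc_eval q (nc_mult t u) = nc_eval q t * nc_eval q u"
  by (induction t) (auto simp: algebra_simps nc_eval_nc_add nc_eval_scale)

lemma nc_eval_null: "nc_null t \<Longrightarrow> nc_eval q t = 0"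
  by (induction t) (simp_all add: poly_eval_eq_0)

lemma nc_eval_plus: "nc_eval q (t + u) = nc_eval q t + nc_eval q u"
  by (simp add: plus_ncpoly_def nc_eval_nc_add)

lemma nc_eval_times: "nc_eval q (t * u) = nc_eval q t * nc_eval q u"
  by (simp add: times_ncpoly_def nc_eval_nc_mult)

lemma nc_eval_minus: "nc_eval q (t - u) = nc_eval q t - nc_eval q u"
  by (simp add: minus_ncpoly_def nc_eval_nc_add nc_eval_scale scal_uminus)

lemma nc_eval_gen: "nc_eval q (nc_gen x) = gen x"
  by (cases x) simp_all

lemma nc_eval_comm: "nc_eval q (comm t u) = comm (nc_eval q t) (nc_eval q u)"
  by (simp add: comm_def nc_eval_minus nc_eval_times)

lemma nc_eval_anticomm: "nc_eval q (anticomm t u) = anticomm (nc_eval q t) (nc_eval q u)"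
  by (simp add: anticomm_def nc_eval_plus nc_eval_times)

lemmas nc_eval_hom = nc_eval_plus nc_eval_minus nc_eval_times nc_eval_scale nc_eval_gen
  nc_eval_comm nc_eval_anticomm

section \<open>The polynomial identities\<close>

lemmas relation_defs = relation1_def relation2_def relation3_def relation4_def
  combination1_def combination2_def combination3_def combination4_def
  lnbr_def list.sel foldl.simps

text \<open>A finite computation with words of length at most 5 and coefficients that are
  polynomials in an indeterminate q. In the fourth identity the combination produces q^3 times the
  relation.\<close>

lemma nc_identities:
  defines "A \<equiv> nc_gen gA" and "B \<equiv> nc_gen gB" and "C \<equiv> nc_gen gC"
  defines "a \<equiv> nc_alpha A B C" and "b \<equiv> nc_alpha B C A" and "g \<equiv> nc_alpha C A B"
  shows "nc_null (relation1 nc_scale A B C - combination1 nc_scale A B C a b g)"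
    and "nc_null (relation2 nc_scale A B C - combination2 nc_scale A B C a b g)"
    and "nc_null (relation3 nc_scale A B C - combination3 nc_scale A B C a b g)"
    and "nc_null (nc_scale [0,0,0,1] (relation4 A B C) - combination4 nc_scale A B C a b g)"
  unfolding A_def B_def C_def a_def b_def g_def by code_simp+

text \<open>Evaluation respects every operation occurring in the relations and combinations, so the
  symbolic identities specialise to any q in any field.\<close>

lemma free_identities:
  fixes q :: "'a::field"
  defines "A \<equiv> gen gA" and "B \<equiv> gen gB" and "C \<equiv> gen gC"
  defines "a \<equiv> nc_eval q (nc_alpha (nc_gen gA) (nc_gen gB) (nc_gen gC))"
    and "b \<equiv> nc_eval q (nc_alpha (nc_gen gB) (nc_gen gC) (nc_gen gA))"
    and "g \<equiv> nc_eval q (nc_alpha (nc_gen gC) (nc_gen gA) (nc_gen gB))"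
  shows "relation1 (act q) A B C = combination1 (act q) A B C a b g"
    and "relation2 (act q) A B C = combination2 (act q) A B C a b g"
    and "relation3 (act q) A B C = combination3 (act q) A B C a b g"
    and "act q [0,0,0,1] (relation4 A B C) = combination4 (act q) A B C a b g"
  using nc_identities[THEN nc_eval_null[of _ q]]
  by (simp_all only: relation_defs assms nc_eval_hom right_minus_eq)

section \<open>The ideal\<close>

lemma aw_ideal_add: "x \<in> aw_ideal q \<Longrightarrow> y \<in> aw_ideal q \<Longrightarrow> x + y \<in> aw_ideal q"
  using additive_subgroup.a_closed[OF ideal.axioms(1)[OF aw_ideal_is_ideal]]
  by (fastforce simp: ring_of_type_algebra_def)

lemma aw_ideal_mult_left: "x \<in> aw_ideal q \<Longrightarrow> y * x \<in> aw_ideal q"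
  using ideal.I_l_closed[OF aw_ideal_is_ideal, of x q y] by (simp add: ring_of_type_algebra_def)

lemma aw_ideal_mult_right: "x \<in> aw_ideal q \<Longrightarrow> x * y \<in> aw_ideal q"
  using ideal.I_r_closed[OF aw_ideal_is_ideal, of x q y] by (simp add: ring_of_type_algebra_def)

lemma aw_ideal_diff: "x \<in> aw_ideal q \<Longrightarrow> y \<in> aw_ideal q \<Longrightarrow> x - y \<in> aw_ideal q"
  using aw_ideal_add[of x q "(- 1) * y"] aw_ideal_mult_left[of y q "- 1"] by simp

lemma aw_ideal_comm: "x \<in> aw_ideal q \<Longrightarrow> comm y x \<in> aw_ideal q"
  by (simp add: comm_def aw_ideal_diff aw_ideal_mult_left aw_ideal_mult_right)

lemma aw_ideal_anticomm: "x \<in> aw_ideal q \<Longrightarrow> anticomm y x \<in> aw_ideal q"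
  by (simp add: anticomm_def aw_ideal_add aw_ideal_mult_left aw_ideal_mult_right)

lemma generator_in_aw_ideal:
  assumes "d \<in> {aw_alpha q, aw_beta q, aw_gamma q}"
  shows "comm (gen x) d \<in> aw_ideal q"
proof -
  let ?S = "{gen x * d - d * gen x | x d. d \<in> {aw_alpha q, aw_beta q, aw_gamma q}}"
  have "?S \<subseteq> aw_ideal q"
    unfolding aw_ideal_def by (rule ring.genideal_self[OF ring_free_ring]) simp
  then show ?thesis
    using assms unfolding comm_def by blast
qed

lemma comm_act: "comm x (scal c * d) = scal c * comm x d"
  by (simp add: comm_def right_diff_distrib mult_scal_left_commute mult.assoc)

text \<open>Links the denominator-free model to alpha, beta and gamma; the hypotheses make
  \<open>inverse\<close> a true inverse of q and of q - q^{-1}, so that the denominators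
  cancel.\<close>

lemma nc_eval_alpha:
  assumes "q \<noteq> 0" and "q - inverse q \<noteq> 0"
  shows "nc_eval q (nc_alpha (nc_gen x) (nc_gen y) (nc_gen z)) =
    scal (q^2 * (q - inverse q)) *
      (scal (q + inverse q) * gen x
       + scal (inverse (q - inverse q)) * (scal q * gen y * gen z - scal (inverse q) * gen z * gen y))"
proof -
  have "q^2 * (q - inverse q) * (q + inverse q) = poly_eval q [-1,0,0,0,1]"
    "q^2 * (q - inverse q) * inverse (q - inverse q) * q = poly_eval q [0,0,0,1]"
    "q^2 * (q - inverse q) * inverse (q - inverse q) * inverse q = poly_eval q [0,1]"
    using assms by (simp_all add: field_simps power2_eq_square)
  then show ?thesis
    unfolding nc_alpha_def nc_eval_hom
    by (simp only: distrib_left right_diff_distrib flip: mult.assoc scal_mult)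
      (simp add: mult.assoc)
qed

text \<open>Since scalars are central, such a commutator is a scalar multiple of one of the nine
  generators of the ideal.\<close>

lemma comm_nc_alpha_in_aw_ideal:
  assumes "q \<noteq> 0" and "q - inverse q \<noteq> 0"
    and "(y, z, w) \<in> {(gA, gB, gC), (gB, gC, gA), (gC, gA, gB)}"
  shows "comm (gen x) (nc_eval q (nc_alpha (nc_gen y) (nc_gen z) (nc_gen w))) \<in> aw_ideal q"
  unfolding nc_eval_alpha[OF assms(1,2)] comm_act
  by (rule aw_ideal_mult_left, rule generator_in_aw_ideal)
    (use assms(3) in \<open>auto simp: aw_alpha_def aw_beta_def aw_gamma_def\<close>)

lemma relations_in_aw_ideal:
  assumes "q \<noteq> 0" and "q - inverse q \<noteq> 0"
  shows "relation1 (act q) (gen gA) (gen gB) (gen gC) \<in> aw_ideal q"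
    and "relation2 (act q) (gen gA) (gen gB) (gen gC) \<in> aw_ideal q"
    and "relation3 (act q) (gen gA) (gen gB) (gen gC) \<in> aw_ideal q"
    and "act q [0,0,0,1] (relation4 (gen gA) (gen gB) (gen gC)) \<in> aw_ideal q"
proof -
  note nc = comm_nc_alpha_in_aw_ideal[OF assms]
  have I: "comm (gen x) (nc_eval q (nc_alpha (nc_gen gA) (nc_gen gB) (nc_gen gC))) \<in> aw_ideal q"
    "comm (gen x) (nc_eval q (nc_alpha (nc_gen gB) (nc_gen gC) (nc_gen gA))) \<in> aw_ideal q"
    "comm (gen x) (nc_eval q (nc_alpha (nc_gen gC) (nc_gen gA) (nc_gen gB))) \<in> aw_ideal q" for x
    by (rule nc, simp)+
  show "relation1 (act q) (gen gA) (gen gB) (gen gC) \<in> aw_ideal q"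
    "relation2 (act q) (gen gA) (gen gB) (gen gC) \<in> aw_ideal q"
    "relation3 (act q) (gen gA) (gen gB) (gen gC) \<in> aw_ideal q"
    "act q [0,0,0,1] (relation4 (gen gA) (gen gB) (gen gC)) \<in> aw_ideal q"
    \<comment> \<open>Every summand of a combination contains a commutator of a generator with
      \<open>a\<close>, \<open>b\<close> or \<open>g\<close>. By \<open>I\<close> that factor is in
      the ideal, and products, commutators and anticommutators with it stay there.\<close>
    unfolding free_identities
      combination1_def combination2_def combination3_def combination4_def
    by (simp_all only: I aw_ideal_add aw_ideal_diff aw_ideal_mult_left aw_ideal_mult_right
        aw_ideal_comm aw_ideal_anticomm)
qed

section \<open>The quotient\<close>

text \<open>A nonzero scalar is invertible, so membership of x - y in the ideal may be tested after
  clearing denominators by K.\<close>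

lemma AW_eqI:
  assumes "K \<noteq> 0" and "scal K * (x - y) \<in> aw_ideal q"
  shows "aw_ideal q +>\<^bsub>free_ring\<^esub> x = aw_ideal q +>\<^bsub>free_ring\<^esub> y"
proof -
  have "x - y = scal (inverse K) * (scal K * (x - y))"
    using assms(1) by (simp flip: mult.assoc scal_mult)
  then have "x - y \<in> aw_ideal q"
    by (metis assms(2) aw_ideal_mult_left)
  moreover have "x \<ominus>\<^bsub>free_ring\<^esub> y = x - y"
  proof -
    have "\<ominus>\<^bsub>free_ring\<^esub> y = - y"
      by (rule abelian_group.minus_equality[OF ring.is_abelian_group[OF ring_free_ring]])
        (simp_all add: ring_of_type_algebra_def)
    then show ?thesis
      by (simp add: a_minus_def) (simp add: ring_of_type_algebra_def)
  qed
  ultimately show ?thesis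
    by (metis ring.quotient_eq_iff_same_a_r_cos[OF ring_free_ring aw_ideal_is_ideal]
        carrier_free_ring UNIV_I)
qed

section \<open>The canonical projection as a homomorphism\<close>

lemma AW_ring_hom: "ring_hom_ring free_ring (AW_algebra q) ((+>\<^bsub>free_ring\<^esub>) (aw_ideal q))"
  using ideal.rcos_ring_hom[OF aw_ideal_is_ideal, of q]
  by (intro ring_hom_ringI2 ring_free_ring ring_AW_algebra)
    (simp add: ring_hom_def AW_algebra_def Let_def)

context
  fixes q :: "'a::field" and D and \<pi>
  defines "D \<equiv> AW_algebra q" and "\<pi> \<equiv> (+>\<^bsub>free_ring\<^esub>) (aw_ideal q)"
begin

interpretation ring_hom_ring free_ring D \<pi>
  unfolding D_def \<pi>_def by (rule AW_ring_hom)

lemma AW_add: "\<pi> x \<oplus>\<^bsub>D\<^esub> \<pi> y = \<pi> (x + y)"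
  using hom_add[of x y] by (simp add: ring_of_type_algebra_def)

lemma AW_mult: "\<pi> x \<otimes>\<^bsub>D\<^esub> \<pi> y = \<pi> (x * y)"
  using hom_mult[of x y] by (simp add: ring_of_type_algebra_def)

lemma AW_uminus: "\<ominus>\<^bsub>D\<^esub> \<pi> x = \<pi> (- x)"
proof (rule S.minus_equality)
  have "0 = \<zero>\<^bsub>free_ring :: 'a free_alg ring\<^esub>"
    by (simp add: ring_of_type_algebra_def)
  then show "\<pi> (- x) \<oplus>\<^bsub>D\<^esub> \<pi> x = \<zero>\<^bsub>D\<^esub>"
    by (metis AW_add add.left_inverse hom_zero)
qed simp_all

lemma AW_diff: "\<pi> x \<ominus>\<^bsub>D\<^esub> \<pi> y = \<pi> (x - y)"
  by (simp add: a_minus_def AW_add AW_uminus)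

lemma AW_smult: "c \<odot>\<^bsub>D\<^esub> \<pi> x = \<pi> (scal c * x)"
  by (simp add: D_def \<pi>_def AW_smult_coset)

lemma AW_lie_bracket: "lie_bracket D (\<pi> x) (\<pi> y) = \<pi> (comm x y)"
  by (simp add: lie_bracket_def comm_def AW_mult AW_diff)

end

lemmas AW_hom = AW_add AW_uminus AW_diff AW_smult AW_lie_bracket

section \<open>Closure properties of generated Lie subalgebras\<close>

lemma lie_generated_bracket:
  "x \<in> lie_generated M S \<Longrightarrow> y \<in> lie_generated M S \<Longrightarrow> lie_bracket M x y \<in> lie_generated M S"
  by (auto simp: lie_generated_def lie_subalgebra_def)

lemma lie_generated_smult:
  fixes M :: "('a::field, 'b, 'm) module_scheme"
  assumes "x \<in> lie_generated M S"
  shows "c \<odot>\<^bsub>M\<^esub> x \<in> lie_generated M S"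
  unfolding lie_generated_def
proof clarify
  fix H assume H: "lie_subalgebra M H" "S \<subseteq> H"
  then have "x \<in> H"
    using assms by (auto simp: lie_generated_def)
  moreover have "submodule H (ring_of_type_algebra :: 'a ring) M"
    using H(1) by (simp add: lie_subalgebra_def)
  ultimately show "c \<odot>\<^bsub>M\<^esub> x \<in> H"
    using submodule.smult_closed[of H "ring_of_type_algebra :: 'a ring" M c x]
    by (simp add: ring_of_type_algebra_def)
qed

section \<open>Membership in L and descent of the relations to the quotient\<close>

theorem theorem7p2:
  fixes q :: "'a::alg_closed_field"
    and D :: "('a, 'a free_alg set) module" (structure)
    and L :: "'a free_alg set set"
    and A B C :: "'a free_alg set"
  assumes q_nonzero: "q \<noteq> 0" and q4: "q^4 \<noteq> 1" and two_nonzero: "(2::'a) \<noteq> 0"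
    and D_eq: "D = AW_algebra q"
    and A_eq: "A = AW_gen q gA" and B_eq: "B = AW_gen q gB" and C_eq: "C = AW_gen q gC"
    and L_eq: "L = lie_generated D {A, B, C}"
  shows "((1 / (q - inverse q)) \<odot> \<langle>[B, A, A, B, C]\<rangle> \<in> L \<and>
      (1 / (q - inverse q)) \<odot> \<langle>[B, A, A, B, C]\<rangle> =
        \<ominus> (((2 * q^2 + 1) * (q^2 + 2) / (2 * q^2 * (q + inverse q)^2 * (q - inverse q))) \<odot>
             (\<lbrace>\<langle>[B, A, A]\<rangle>, \<langle>[C, B]\<rangle>\<rbrace> \<oplus> \<lbrace>\<langle>[B, A, B]\<rangle>, \<langle>[C, A]\<rangle>\<rbrace>))
         \<ominus> ((q^4 + 3 * q^2 + 1) / (2 * q^2 * (q + inverse q)^2 * (q - inverse q))) \<odot>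
             (\<lbrace>\<langle>[B, A, C]\<rangle>, \<langle>[B, A]\<rangle>\<rbrace> \<ominus> 2 \<odot> \<lbrace>\<langle>[C, A, B]\<rangle>, \<langle>[B, A]\<rangle>\<rbrace>)
         \<ominus> \<langle>[B, A, C, C]\<rangle> \<oplus> 2 \<odot> \<langle>[C, A, B, C]\<rangle> \<ominus> \<langle>[B, A, B, B]\<rangle> \<oplus> \<langle>[B, A, A, A]\<rangle>) \<and>
    ((1 / (2 * (q + inverse q)^2 * (q - inverse q))) \<odot> \<lbrace>\<langle>[C, B, B]\<rangle>, \<langle>[C, A]\<rangle>\<rbrace> \<in> L \<and>
      (1 / (2 * (q + inverse q)^2 * (q - inverse q))) \<odot> \<lbrace>\<langle>[C, B, B]\<rangle>, \<langle>[C, A]\<rangle>\<rbrace> =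
        (- (3 * q^4 + 5 * q^2 + 3) / (2 * q^2 * (q + inverse q)^2 * (q - inverse q))) \<odot> \<lbrace>\<langle>[B, A, C]\<rangle>, \<langle>[C, B]\<rangle>\<rbrace>
         \<oplus> ((q^4 + 3 * q^2 + 1) / (2 * q^2 * (q + inverse q)^2 * (q - inverse q))) \<odot> \<lbrace>\<langle>[C, A, B]\<rangle>, \<langle>[C, B]\<rangle>\<rbrace>
         \<oplus> ((2 * q^4 + 3 * q^2 + 2) / (2 * q^2 * (q + inverse q)^2 * (q - inverse q))) \<odot> \<lbrace>\<langle>[C, B, C]\<rangle>, \<langle>[B, A]\<rangle>\<rbrace>
         \<ominus> (1 / (q - inverse q)) \<odot> (\<langle>[B, A, B, C, C]\<rangle> \<ominus> \<langle>[C, A, B, B, C]\<rangle>)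
         \<oplus> \<langle>[C, B, C, C]\<rangle> \<oplus> \<langle>[B, A, A, C]\<rangle> \<ominus> \<langle>[C, B, B, B]\<rangle> \<oplus> \<langle>[C, A, A, B]\<rangle>) \<and>
    ((1 / (2 * (q + inverse q)^2 * (q - inverse q))) \<odot> \<lbrace>\<langle>[C, A, A]\<rangle>, \<langle>[C, B]\<rangle>\<rbrace> \<in> L \<and>
      (1 / (2 * (q + inverse q)^2 * (q - inverse q))) \<odot> \<lbrace>\<langle>[C, A, A]\<rangle>, \<langle>[C, B]\<rangle>\<rbrace> =
        ((q^4 + 3 * q^2 + 1) / (2 * q^2 * (q + inverse q)^2 * (q - inverse q))) \<odot>
             ((- 2) \<odot> \<lbrace>\<langle>[B, A, C]\<rangle>, \<langle>[C, A]\<rangle>\<rbrace> \<oplus> \<lbrace>\<langle>[C, A, B]\<rangle>, \<langle>[C, A]\<rangle>\<rbrace>)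
         \<oplus> ((2 * q^2 + 1) * (q^2 + 2) / (2 * q^2 * (q + inverse q)^2 * (q - inverse q))) \<odot> \<lbrace>\<langle>[C, A, C]\<rangle>, \<langle>[B, A]\<rangle>\<rbrace>
         \<oplus> (1 / (q - inverse q)) \<odot> \<langle>[C, A, A, B, C]\<rangle> \<ominus> 2 \<odot> \<lbrace>\<langle>[C, B]\<rangle>, \<langle>[B, A]\<rangle>\<rbrace>
         \<ominus> \<langle>[C, A, C, C]\<rangle> \<oplus> 2 \<odot> \<langle>[B, A, B, C]\<rangle> \<ominus> \<langle>[C, A, B, B]\<rangle> \<oplus> \<langle>[C, A, A, A]\<rangle>) \<and>
    (\<lbrace>\<langle>[C, A, C]\<rangle>, \<langle>[C, B]\<rangle>\<rbrace> \<in> L \<and>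
      \<lbrace>\<langle>[C, A, C]\<rangle>, \<langle>[C, B]\<rangle>\<rbrace> =
        \<ominus> \<lbrace>\<langle>[B, A, B]\<rangle>, \<langle>[C, B]\<rangle>\<rbrace> \<oplus> \<lbrace>\<langle>[C, B, C]\<rangle>, \<langle>[C, A]\<rangle>\<rbrace> \<ominus> \<lbrace>\<langle>[B, A, A]\<rangle>, \<langle>[C, A]\<rangle>\<rbrace>
         \<oplus> \<lbrace>\<langle>[C, B, B]\<rangle>, \<langle>[B, A]\<rangle>\<rbrace> \<oplus> \<lbrace>\<langle>[C, A, A]\<rangle>, \<langle>[B, A]\<rangle>\<rbrace>)"
proof -
  \<comment> \<open>Here S H = q^4 - 1, so the hypothesis on q^4 makes both q + q^{-1} = S/q and q -
    q^{-1} = H/q nonzero.\<close>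
  define S H where "S = q^2 + 1" and "H = q^2 - 1"
  have "S * H \<noteq> 0"
    using q4 by (simp add: S_def H_def algebra_simps flip: power_add)
  then have SH: "S \<noteq> 0" "H \<noteq> 0"
    by auto
  have s: "q + inverse q = S / q" and h: "q - inverse q = H / q"
    using q_nonzero by (simp_all add: S_def H_def field_simps power2_eq_square)
  define K where "K = 4 * q^4 * (q + inverse q)^2 * (q - inverse q)"
  have K0: "K \<noteq> 0"
  proof -
    have "(4::'a) = 2 * 2"
      by simp
    then have "(4::'a) \<noteq> 0"
      using two_nonzero by (metis mult_eq_0_iff)
    then show ?thesis
      using q_nonzero SH by (simp add: K_def s h)
  qed
  \<comment> \<open>K equals 4 q (q^2 + 1)^2 (q^2 - 1), and K times each fractional coefficient of
    the theorem is one of the polynomials listed in \<open>relation1\<close> to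
    \<open>relation3\<close>.\<close>
  have coeffs:
    "K = poly_eval q [0,-4,0,-4,0,4,0,4]"
    "K * (1 / (q - inverse q)) = poly_eval q [0,0,4,0,8,0,4]"
    "K * (1 / (2 * (q + inverse q)^2 * (q - inverse q))) = poly_eval q [0,0,0,0,2]"
    "K * ((2 * q^2 + 1) * (q^2 + 2) / (2 * q^2 * (q + inverse q)^2 * (q - inverse q))) =
      poly_eval q [0,0,4,0,10,0,4]"
    "K * ((q^4 + 3 * q^2 + 1) / (2 * q^2 * (q + inverse q)^2 * (q - inverse q))) =
      poly_eval q [0,0,2,0,6,0,2]"
    "K * (- (3 * q^4 + 5 * q^2 + 3) / (2 * q^2 * (q + inverse q)^2 * (q - inverse q))) =
      poly_eval q [0,0,-6,0,-10,0,-6]"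
    "K * ((2 * q^4 + 3 * q^2 + 2) / (2 * q^2 * (q + inverse q)^2 * (q - inverse q))) =
      poly_eval q [0,0,4,0,6,0,4]"
    unfolding K_def s h using q_nonzero two_nonzero SH
    by (simp_all add: field_simps) (simp_all add: S_def H_def power_numeral_reduce algebra_simps)
  have hq: "q - inverse q \<noteq> 0"
    using SH q_nonzero by (simp add: h)
  have two: "poly_eval q [2] = 2" "poly_eval q [-2] = -2"
    by simp_all
  note rel = relations_in_aw_ideal[OF q_nonzero hq]
  \<comment> \<open>Distributivity is restricted to the type of the free algebra: field coefficients
    must not be multiplied out, or they would no longer match \<open>coeffs\<close>.\<close>
  note expand = relation_defs two scal_mult[symmetric]
    distrib_left[where ?'a = "'a free_alg"] right_diff_distrib[where ?'a = "'a free_alg"]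
    mult_minus_left[where ?'a = "'a free_alg"] mult_minus_right[where ?'a = "'a free_alg"]
    mult.assoc[where ?'a = "'a free_alg", symmetric]
  \<comment> \<open>These rules collapse each side of a relation to the coset of a single element of
    the free algebra, the form that \<open>AW_eqI\<close> expects.\<close>
  note push = D_eq A_eq B_eq C_eq AW_gen_def left_normed_def list.sel foldl.simps AW_hom
  have gens: "A \<in> L" "B \<in> L" "C \<in> L"
    using generators_in_lie_generated[of "{A, B, C}" D] by (auto simp: L_eq)
  have mem: "\<lbrace>x, y\<rbrace> \<in> L" if "x \<in> L" "y \<in> L" for x y
    using that by (simp add: L_eq lie_generated_bracket)
  have mem': "c \<odot> x \<in> L" if "x \<in> L" for x c
    using that by (simp add: L_eq lie_generated_smult)
  note in_L = left_normed_def gens mem mem'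
  show ?thesis
  proof (intro conjI, goal_cases)
    case 1 show ?case by (simp add: in_L)
  next
    \<comment> \<open>The rule \<open>coeffs(1)\<close> is used from right to left: K must stay
      folded so that the products of K with the other coefficients are recognised by
      \<open>coeffs\<close>.\<close>
    case 2 show ?case
      unfolding push
      by (rule AW_eqI[OF K0])
        (insert rel(1), simp only: expand, simp only: coeffs flip: coeffs(1) mult.assoc,
          simp add: algebra_simps del: poly_eval.simps)
  next
    case 3 show ?case by (simp add: in_L)
  next
    case 4 show ?case
      unfolding push
      by (rule AW_eqI[OF K0])
        (insert rel(2), simp only: expand, simp only: coeffs flip: coeffs(1) mult.assoc,
          simp add: algebra_simps del: poly_eval.simps)
  next
    case 5 show ?case by (simp add: in_L)
  next
    case 6 show ?case
      unfolding push
      by (rule AW_eqI[OF K0])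
        (insert rel(3), simp only: expand, simp only: coeffs flip: coeffs(1) mult.assoc,
          simp add: algebra_simps del: poly_eval.simps)
  next
    case 7 show ?case by (simp add: in_L)
  next
    \<comment> \<open>The fourth relation has no denominators; the scalar to cancel is the q^3
      coming from its combination.\<close>
    case 8 show ?case
      unfolding push
      by (rule AW_eqI[of "poly_eval q [0,0,0,1]"])
        (use q_nonzero rel(4) in \<open>simp_all add: relation_defs algebra_simps\<close>)
  qed
qed

end
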